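(* Let $C_1$ be a clone on $\{0,1\}$ that is a subclone of $\Omega_{0*}$ or of $\Omega_{*1}$. Then: (i) $\mathcal{L}_{(C_1,J)}$ is uncountable if and only if $\mathcal{L}_{(C_1,I^* )}$ is uncountable. (ii) $\mathcal{L}_{(C_1,J)}$ is countably infinite if and only if $\mathcal{L}_{(C_1,I^* )}$ is countably infinite. (iii) $\mathcal{L}_{(C_1,J)}$ is finite if and only if $\mathcal{L}_{(C_1,I^* )}$ is finite.
   Context: A Boolean function is a map $f \colon \{0,1\}^n \to \{0,1\}$ for some integer $n \geq 1$ (its arity). If $f$ is $n$-ary and $g_1,\dots,g_n$ are $m$-ary, then $f(g_1,\dots,g_n)$ is the $m$-ary function $\mathbf{a} \mapsto f(g_1(\mathbf{a}),\dots,g_n(\mathbf{a}))$. For sets $F, G$ of Boolean functions, $FG$ is the set of all composites $f(g_1,\dots,g_n)$ with $f \in F$ of some arity $n$ and $g_1,\dots,g_n \in G$ all of a common arity. A clone on $\{0,1\}$ is a set $C$ of Boolean functions containing all projections and satisfying $CC \subseteq C$. For clones $C_1,C_2$ on $\{0,1\}$, a (possibly empty) set $K$ of Boolean functions is a $(C_1,C_2)$-clonoid if $KC_1 \subseteq K$ and $C_2K \subseteq K$; $\mathcal{L}_{(C_1,C_2)}$ is the lattice (under inclusion) of all $(C_1,C_2)$-clonoids. $\Omega_{0*}$ is the clone of all Boolean functions $f$ with $f(0,\dots,0)=0$; $\Omega_{*1}$ is the clone of all Boolean functions $f$ with $f(1,\dots,1)=1$. $J$ is the clone of all projections on $\{0,1\}$;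 $I^*$ is the clone of all projections and negated projections. *)

theory Defs
  imports Main "HOL-Library.FuncSet" "HOL-Library.Countable_Set"
begin

text \<open>
  The Boolean values 0 and 1 are \<open>False\<close> and \<open>True\<close>, and a point of the n-cube is a list of
  length n.  A Boolean function is a pair of its arity and its operation; the latter is required to
  be extensional on the cube, so that equality of pairs is equality of Boolean functions and sets of
  functions (or of clonoids) have the intended cardinality.
\<close>

type_synonym bfun = "nat \<times> (bool list \<Rightarrow> bool)"

abbreviation arity :: "bfun \<Rightarrow> nat" where
  "arity \<equiv> fst"

abbreviation op_of :: "bfun \<Rightarrow> bool list \<Rightarrow> bool" where
  "op_of \<equiv> snd"

definition cube :: "nat \<Rightarrow> bool list set" where
  "cube n = {a. length a = n}"

definition Boolean_functions :: "bfun set" where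
  "Boolean_functions = (SIGMA n:{1..}. cube n \<rightarrow>\<^sub>E UNIV)"

text \<open>\<open>bcomp m f [g\<^sub>1, \<dots>, g\<^sub>n]\<close> is the m-ary function $f(g_1,\dots,g_n)$;
  it is meaningful if f is n-ary and all inner functions are m-ary.\<close>

definition bcomp :: "nat \<Rightarrow> bfun \<Rightarrow> bfun list \<Rightarrow> bfun" where
  "bcomp m f gs = (m, \<lambda>a\<in>cube m. op_of f (map (\<lambda>g. op_of g a) gs))"

definition class_comp :: "bfun set \<Rightarrow> bfun set \<Rightarrow> bfun set" where
  "class_comp F G =
    {bcomp m f gs | m f gs.
       f \<in> F \<and> length gs = arity f \<and> (\<forall>g\<in>set gs. g \<in> G \<and> arity g = m)}"

definition projection :: "nat \<Rightarrow> nat \<Rightarrow> bfun" where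
  "projection n i = (n, \<lambda>a\<in>cube n. a ! i)"

definition neg_projection :: "nat \<Rightarrow> nat \<Rightarrow> bfun" where
  "neg_projection n i = (n, \<lambda>a\<in>cube n. \<not> a ! i)"

definition J :: "bfun set" where
  "J = {projection n i | n i. i < n}"

definition I_star :: "bfun set" where
  "I_star = J \<union> {neg_projection n i | n i. i < n}"

definition Omega_0_any :: "bfun set" where
  "Omega_0_any = {f \<in> Boolean_functions. op_of f (replicate (arity f) False) = False}"

definition Omega_any_1 :: "bfun set" where
  "Omega_any_1 = {f \<in> Boolean_functions. op_of f (replicate (arity f) True) = True}"

definition is_clone :: "bfun set \<Rightarrow> bool" where
  "is_clone C \<longleftrightarrow> C \<subseteq> Boolean_functions \<and> J \<subseteq> C \<and> class_comp C C \<subseteq> C"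

definition is_clonoid :: "bfun set \<Rightarrow> bfun set \<Rightarrow> bfun set \<Rightarrow> bool" where
  "is_clonoid C1 C2 K \<longleftrightarrow>
     K \<subseteq> Boolean_functions \<and> class_comp K C1 \<subseteq> K \<and> class_comp C2 K \<subseteq> K"

text \<open>The carrier of the lattice of clonoids; its order is inclusion.\<close>

definition clonoids :: "bfun set \<Rightarrow> bfun set \<Rightarrow> bfun set set" where
  "clonoids C1 C2 = {K. is_clonoid C1 C2 K}"

lemma is_clone_J: "is_clone J"
proof -
  have "class_comp J J \<subseteq> J"
  proof
    fix h assume "h \<in> class_comp J J"
    then obtain m n i gs where h: "h = bcomp m (projection n i) gs" and i: "i < n"
      and len: "length gs = n" and gs: "\<forall>g\<in>set gs. g \<in> J \<and> arity g = m"
      unfolding class_comp_def by (auto simp: J_def projection_def)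
    have "gs ! i \<in> J" "arity (gs ! i) = m" using gs i len by auto
    moreover have "h = gs ! i"
      using calculation i len unfolding h
      by (auto simp: bcomp_def J_def projection_def cube_def restrict_def fun_eq_iff)
    ultimately show "h \<in> J" by simp
  qed
  then show ?thesis
    by (auto simp: is_clone_def J_def projection_def Boolean_functions_def)
qed

lemma is_clone_I_star: "is_clone I_star"
proof -
  have "class_comp I_star I_star \<subseteq> I_star"
  proof
    fix h assume "h \<in> class_comp I_star I_star"
    then obtain m f gs where h: "h = bcomp m f gs" and f: "f \<in> I_star"
      and len: "length gs = arity f" and gs: "\<forall>g\<in>set gs. g \<in> I_star \<and> arity g = m"
      unfolding class_comp_def by blast
    from f obtain n i where i: "i < n" and fe: "f = projection n i \<or> f = neg_projection n i"
      by (auto simp: I_star_def J_def)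
    have l: "length gs = n" using fe len by (auto simp: projection_def neg_projection_def)
    have "gs ! i \<in> I_star" "arity (gs ! i) = m" using gs i l by auto
    then obtain j where j: "j < m" and g: "gs ! i = projection m j \<or> gs ! i = neg_projection m j"
      by (auto simp: I_star_def J_def projection_def neg_projection_def)
    have "h = projection m j \<or> h = neg_projection m j"
      using fe g i l unfolding h
      by (auto simp: bcomp_def projection_def neg_projection_def cube_def restrict_def fun_eq_iff)
    then show "h \<in> I_star" using j by (auto simp: I_star_def J_def)
  qed
  then show ?thesis
    by (auto simp: is_clone_def I_star_def J_def projection_def neg_projection_def
        Boolean_functions_def)
qed

lemma is_clone_Omega_0_any: "is_clone Omega_0_any"
proof -
  have "class_comp Omega_0_any Omega_0_any \<subseteq> Omega_0_any"
  proof
    fix h assume "h \<in> class_comp Omega_0_any Omega_0_any"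
    then obtain m f gs where h: "h = bcomp m f gs" and f: "f \<in> Omega_0_any"
      and len: "length gs = arity f" and gs: "\<forall>g\<in>set gs. g \<in> Omega_0_any \<and> arity g = m"
      unfolding class_comp_def by blast
    have "arity f \<ge> 1" using f by (auto simp: Omega_0_any_def Boolean_functions_def)
    then have "gs \<noteq> []" using len by auto
    then have m: "m \<ge> 1"
      using gs by (cases gs) (auto simp: Omega_0_any_def Boolean_functions_def)
    have "map (\<lambda>g. op_of g (replicate m False)) gs = replicate (arity f) False"
      using gs len by (auto simp: Omega_0_any_def list_eq_iff_nth_eq all_set_conv_all_nth)
    then show "h \<in> Omega_0_any" using f m
      unfolding h by (auto simp: Omega_0_any_def Boolean_functions_def bcomp_def cube_def)
  qed
  then show ?thesis
    by (auto simp: is_clone_def Omega_0_any_def J_def projection_def Boolean_functions_def cube_def)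
qed

lemma is_clone_Omega_any_1: "is_clone Omega_any_1"
proof -
  have "class_comp Omega_any_1 Omega_any_1 \<subseteq> Omega_any_1"
  proof
    fix h assume "h \<in> class_comp Omega_any_1 Omega_any_1"
    then obtain m f gs where h: "h = bcomp m f gs" and f: "f \<in> Omega_any_1"
      and len: "length gs = arity f" and gs: "\<forall>g\<in>set gs. g \<in> Omega_any_1 \<and> arity g = m"
      unfolding class_comp_def by blast
    have "arity f \<ge> 1" using f by (auto simp: Omega_any_1_def Boolean_functions_def)
    then have "gs \<noteq> []" using len by auto
    then have m: "m \<ge> 1"
      using gs by (cases gs) (auto simp: Omega_any_1_def Boolean_functions_def)
    have "map (\<lambda>g. op_of g (replicate m True)) gs = replicate (arity f) True"
      using gs len by (auto simp: Omega_any_1_def list_eq_iff_nth_eq all_set_conv_all_nth)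
    then show "h \<in> Omega_any_1" using f m
      unfolding h by (auto simp: Omega_any_1_def Boolean_functions_def bcomp_def cube_def)
  qed
  then show ?thesis
    by (auto simp: is_clone_def Omega_any_1_def J_def projection_def Boolean_functions_def cube_def)
qed

end

theory Submission
  imports Defs
begin

text \<open>
  A \<open>(C1, J)\<close>-clonoid is a set closed under composition with \<open>C1\<close> from the right, and a
  \<open>(C1, I_star)\<close>-clonoid is one that is moreover closed under negation.  If every member of \<open>C1\<close>
  fixes the constant tuple b, then composition with \<open>C1\<close> does not change the value of a function
  at b, so the members of a \<open>(C1, J)\<close>-clonoid with value 0 at b and those with value 1 at b form
  \<open>(C1, J)\<close>-clonoids on their own.  Since negation exchanges the two values, each half can be
  recovered from its closure under negation.  Hence the \<open>(C1, J)\<close>-clonoids inject into the pairs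
  of \<open>(C1, I_star)\<close>-clonoids, which are themselves \<open>(C1, J)\<close>-clonoids.
\<close>

definition negate :: "bfun \<Rightarrow> bfun" where
  "negate f = (arity f, \<lambda>a\<in>cube (arity f). \<not> op_of f a)"

lemma negate_Boolean_functions: "f \<in> Boolean_functions \<Longrightarrow> negate f \<in> Boolean_functions"
  by (auto simp: negate_def Boolean_functions_def)

text \<open>Flipping the output twice restores it on the cube. Off the cube both sides are
  \<open>undefined\<close>, because Boolean functions are extensional.\<close>

lemma negate_negate: "f \<in> Boolean_functions \<Longrightarrow> negate (negate f) = f"
  by (cases f)
    (auto simp: negate_def Boolean_functions_def restrict_def fun_eq_iff PiE_def extensional_def)

lemma bcomp_negate:
  "length gs = arity f \<Longrightarrow> bcomp m (negate f) gs = negate (bcomp m f gs)"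
  by (auto simp: bcomp_def negate_def cube_def restrict_def fun_eq_iff)

lemma bcomp_projection:
  assumes "i < length gs" "gs ! i \<in> Boolean_functions" "arity (gs ! i) = m"
  shows "bcomp m (projection (length gs) i) gs = gs ! i"
  using assms
  by (cases "gs ! i")
    (auto simp: bcomp_def projection_def cube_def Boolean_functions_def restrict_def fun_eq_iff
      PiE_def extensional_def)

lemma bcomp_neg_projection:
  assumes "i < length gs" "arity (gs ! i) = m"
  shows "bcomp m (neg_projection (length gs) i) gs = negate (gs ! i)"
  using assms
  by (auto simp: bcomp_def neg_projection_def negate_def cube_def restrict_def fun_eq_iff)

lemma class_comp_mono: "F \<subseteq> F' \<Longrightarrow> class_comp F G \<subseteq> class_comp F' G"
  unfolding class_comp_def by blast

lemma class_comp_Un: "class_comp (F \<union> F') G = class_comp F G \<union> class_comp F' G"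
  unfolding class_comp_def by blast

text \<open>Negation acts on the output of the outer function, so it commutes with substituting
  inner functions.\<close>

lemma class_comp_negate: "class_comp (negate ` F) G \<subseteq> negate ` class_comp F G"
proof
  fix h assume "h \<in> class_comp (negate ` F) G"
  then obtain m f gs where "h = bcomp m (negate f) gs" "f \<in> F" "length gs = arity (negate f)"
    "\<forall>g\<in>set gs. g \<in> G \<and> arity g = m"
    unfolding class_comp_def by blast
  moreover from this have "length gs = arity f" by (simp add: negate_def)
  ultimately have "h = negate (bcomp m f gs)" "bcomp m f gs \<in> class_comp F G"
    unfolding class_comp_def by (simp add: bcomp_negate, blast)
  then show "h \<in> negate ` class_comp F G" by blast
qed

text \<open>Substituting into a projection merely selects one of the inner functions, and these
  already lie in \<open>K\<close>.\<close>

lemma class_comp_J: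
  assumes "K \<subseteq> Boolean_functions"
  shows "class_comp J K \<subseteq> K"
proof
  fix h assume "h \<in> class_comp J K"
  then obtain m f gs where h: "h = bcomp m f gs" and f: "f \<in> J" and len: "length gs = arity f"
    and gs: "\<forall>g\<in>set gs. g \<in> K \<and> arity g = m"
    unfolding class_comp_def by blast
  obtain n i where "i < n" "f = projection n i" using f unfolding J_def by blast
  then have i: "i < length gs" "f = projection (length gs) i"
    using len by (simp_all add: projection_def)
  have "gs ! i \<in> K" "arity (gs ! i) = m" using gs i by auto
  then show "h \<in> K" using h i assms by (auto simp: bcomp_projection)
qed

lemma class_comp_I_star:
  assumes "K \<subseteq> Boolean_functions" "negate ` K \<subseteq> K"
  shows "class_comp I_star K \<subseteq> K"
proof
  fix h assume "h \<in> class_comp I_star K"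
  then obtain m f gs where h: "h = bcomp m f gs" and f: "f \<in> I_star" and len: "length gs = arity f"
    and gs: "\<forall>g\<in>set gs. g \<in> K \<and> arity g = m"
    unfolding class_comp_def by blast
  show "h \<in> K"
  proof (cases "f \<in> J")
    case True
    then have "h \<in> class_comp J K" using h len gs unfolding class_comp_def by blast
    then show ?thesis using class_comp_J[OF assms(1)] by blast
  next
    case False
    then obtain n i where "i < n" "f = neg_projection n i" using f unfolding I_star_def by blast
    then have i: "i < length gs" "f = neg_projection (length gs) i"
      using len by (simp_all add: neg_projection_def)
    have "gs ! i \<in> K" "arity (gs ! i) = m" using gs i by auto
    then show ?thesis using h i assms(2) by (auto simp: bcomp_neg_projection)
  qed
qed

lemma clonoids_J_iff:
  "K \<in> clonoids C J \<longleftrightarrow> K \<subseteq> Boolean_functions \<and> class_comp K C \<subseteq> K"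
  using class_comp_J by (auto simp: clonoids_def is_clonoid_def)

lemma clonoids_I_star_subset: "clonoids C I_star \<subseteq> clonoids C J"
  by (auto simp: clonoids_J_iff) (auto simp: clonoids_def is_clonoid_def)

text \<open>Right closure carries over to the negated copy because negation commutes with
  substitution; closure under negation follows from its being an involution.\<close>

lemma negation_closure_in_clonoids:
  assumes "K \<in> clonoids C J"
  shows "K \<union> negate ` K \<in> clonoids C I_star"
proof -
  have K: "K \<subseteq> Boolean_functions" "class_comp K C \<subseteq> K"
    using assms by (auto simp: clonoids_J_iff)
  have "class_comp (K \<union> negate ` K) C \<subseteq> K \<union> negate ` K"
    using K(2) class_comp_negate[of K C] unfolding class_comp_Un by blast
  moreover have "K \<union> negate ` K \<subseteq> Boolean_functions"
    using K(1) negate_Boolean_functions by blast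
  moreover have "negate ` (K \<union> negate ` K) \<subseteq> K \<union> negate ` K"
    using K(1) by (auto simp: negate_negate subset_iff)
  ultimately show ?thesis
    using class_comp_I_star unfolding clonoids_def is_clonoid_def by blast
qed

definition value_class :: "bool \<Rightarrow> bool \<Rightarrow> bfun set" where
  "value_class b c = {f. op_of f (replicate (arity f) b) = c}"

lemma negate_value_class: "negate f \<in> value_class b c \<longleftrightarrow> f \<in> value_class b (\<not> c)"
  by (auto simp: value_class_def negate_def cube_def)

text \<open>Negation flips the value at the constant tuple b, so the negated copy lies entirely in
  the opposite class and the intersection discards exactly it.\<close>

lemma negation_closure_Int_value_class:
  assumes "K \<subseteq> value_class b c"
  shows "(K \<union> negate ` K) \<inter> value_class b c = K"
  using assms by (auto simp: negate_value_class) (auto simp: value_class_def)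

text \<open>Inner functions that fix the constant tuple b feed the outer function its own constant
  tuple b, so its value there is inherited.\<close>

lemma class_comp_value_class:
  assumes "G \<subseteq> {g. op_of g (replicate (arity g) b) = b}"
  shows "class_comp (value_class b c) G \<subseteq> value_class b c"
proof
  fix h assume "h \<in> class_comp (value_class b c) G"
  then obtain m f gs where h: "h = bcomp m f gs" and f: "f \<in> value_class b c"
    and len: "length gs = arity f" and gs: "\<forall>g\<in>set gs. g \<in> G \<and> arity g = m"
    unfolding class_comp_def by blast
  have "\<forall>g\<in>set gs. op_of g (replicate m b) = b" using gs assms by auto
  then have "map (\<lambda>g. op_of g (replicate m b)) gs = replicate (arity f) b"
    using len by (simp add: list_eq_iff_nth_eq)
  then show "h \<in> value_class b c" using f by (simp add: h value_class_def bcomp_def cube_def)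
qed

lemma clonoids_Int_value_class:
  assumes "C \<subseteq> {g. op_of g (replicate (arity g) b) = b}" "K \<in> clonoids C J"
  shows "K \<inter> value_class b c \<in> clonoids C J"
proof -
  have "class_comp (K \<inter> value_class b c) C \<subseteq> class_comp K C \<inter> class_comp (value_class b c) C"
    by (simp add: class_comp_mono)
  then show ?thesis
    using assms(2) class_comp_value_class[OF assms(1)] by (fastforce simp: clonoids_J_iff)
qed

text \<open>Covering by an image of a product lets countability and finiteness transfer
  directly.\<close>

lemma clonoids_J_subset_image:
  assumes "C \<subseteq> {g. op_of g (replicate (arity g) b) = b}"
  shows "clonoids C J \<subseteq> (\<lambda>(L, M). (L \<inter> value_class b False) \<union> (M \<inter> value_class b True)) `
    (clonoids C I_star \<times> clonoids C I_star)"
proof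
  fix K assume K: "K \<in> clonoids C J"
  \<comment> \<open>The preimage of \<open>K\<close> is the pair of negation closures of its two
    halves.\<close>
  define cl where "cl c = (K \<inter> value_class b c) \<union> negate ` (K \<inter> value_class b c)" for c
  have "cl c \<in> clonoids C I_star" for c
    unfolding cl_def by (intro negation_closure_in_clonoids clonoids_Int_value_class assms K)
  moreover have "cl c \<inter> value_class b c = K \<inter> value_class b c" for c
    unfolding cl_def by (rule negation_closure_Int_value_class) simp
  moreover have "K = (K \<inter> value_class b False) \<union> (K \<inter> value_class b True)"
    by (auto simp: value_class_def)
  ultimately show "K \<in> (\<lambda>(L, M). (L \<inter> value_class b False) \<union> (M \<inter> value_class b True)) `
      (clonoids C I_star \<times> clonoids C I_star)"
    by (intro image_eqI[where x = "(cl False, cl True)"]) auto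
qed

theorem proposition3p11:
  fixes C1 :: "bfun set"
  assumes "is_clone C1"
    and "C1 \<subseteq> Omega_0_any \<or> C1 \<subseteq> Omega_any_1"
  shows "(uncountable (clonoids C1 J) \<longleftrightarrow> uncountable (clonoids C1 I_star)) \<and>
    (countable (clonoids C1 J) \<and> infinite (clonoids C1 J) \<longleftrightarrow>
       countable (clonoids C1 I_star) \<and> infinite (clonoids C1 I_star)) \<and>
    (finite (clonoids C1 J) \<longleftrightarrow> finite (clonoids C1 I_star))"
proof -
  \<comment> \<open>Here b is \<open>False\<close> for a subclone of \<open>Omega_0_any\<close> and
    \<open>True\<close> for one of \<open>Omega_any_1\<close>.\<close>
  obtain b where "C1 \<subseteq> {g. op_of g (replicate (arity g) b) = b}"
    using assms(2) unfolding Omega_0_any_def Omega_any_1_def by blast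
  note image = clonoids_J_subset_image[OF this]
  have "countable (clonoids C1 J) \<longleftrightarrow> countable (clonoids C1 I_star)"
    by (auto intro: countable_subset[OF clonoids_I_star_subset] countable_subset[OF image])
  moreover have "finite (clonoids C1 J) \<longleftrightarrow> finite (clonoids C1 I_star)"
    by (auto intro: finite_subset[OF clonoids_I_star_subset] finite_subset[OF image])
  \<comment> \<open>All three claims are propositional combinations of these two
    equivalences.\<close>
  ultimately show ?thesis by blast
qed

end
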